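(* A polynomial $u\in\mathbb{Z}[x]$ is nilpotent at $4$ (that is, $u\in N_4$) if and only if it has one of the following forms for some $p(x)\in\mathbb{Z}[x]$, and in each case the index of nilpotency at $4$ and the associated finite sequence at $4$ are as stated: (1) $(x-4)p(x)$ (index $1$, associated finite sequence $4,0$); (2) $3(x-3)+p(x)(x-3)(x-4)$ (index $2$, associated finite sequence $4,3,0$); (3) $-3(x-6)+p(x)(x-4)(x-6)$ (index $2$, associated finite sequence $4,6,0$); (4) $x-2+p(x)(x-2)(x-4)$ (index $2$, associated finite sequence $4,2,0$); (5) $-2(x-8)+p(x)(x-4)(x-8)$ (index $2$, associated finite sequence $4,8,0$); (6) $-5(x-5)+p(x)(x-4)(x-5)$ (index $2$, associated finite sequence $4,5,0$); (7) $x-1+p(x)(x-1)(x-2)(x-3)(x-4)$ (index $4$, associated finite sequence $4,3,2,1,0$); (8) $-(2x-13)(x-3)+p(x)(x-3)(x-4)(x-5)(x-6)$ (index $4$, associated finite sequence $4,5,6,3,0$).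
   Context: $\mathbb{N}$ is the set of positive integers. For $u\in\mathbb{Z}[x]$ and $n\in\mathbb{N}$, $u^{(n)}$ denotes the $n$-fold composition $u\circ\cdots\circ u$. For $r\in\mathbb{Z}$, $u$ is called nilpotent at $r$ if there is $n\in\mathbb{N}$ with $u^{(n)}(r)=0$; the smallest such $n$ is called the index (of nilpotency) of $u$ at $r$. The zero polynomial is nilpotent at every $r$ with index $1$. $N_r$ denotes the set of all $u\in\mathbb{Z}[x]$ nilpotent at $r$. If $u$ is nilpotent at $r$ of index $m$, the finite sequence associated to $u$ at $r$ is $r,u(r),\ldots,u^{(m-1)}(r),0$. *)

theory Defs
  imports "HOL-Computational_Algebra.Polynomial"
begin

text \<open>The \<open>n\<close>-fold composition of \<open>u\<close> with itself; for \<open>n = 0\<close> it is the polynomial \<open>x\<close>.\<close>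

definition iter_comp :: "int poly \<Rightarrow> nat \<Rightarrow> int poly" where
  "iter_comp u n = (pcompose u ^^ n) [:0, 1:]"

definition nilpotent_at :: "int poly \<Rightarrow> int \<Rightarrow> bool" where
  "nilpotent_at u r \<longleftrightarrow> (\<exists>n\<ge>1. poly (iter_comp u n) r = 0)"

definition nilpotent_polys :: "int \<Rightarrow> int poly set" where
  "nilpotent_polys r = {u. nilpotent_at u r}"

text \<open>The index and the associated sequence are meaningful only when \<open>u\<close> is nilpotent at \<open>r\<close>.\<close>

definition nilpotency_index :: "int poly \<Rightarrow> int \<Rightarrow> nat" where
  "nilpotency_index u r = (LEAST n. n \<ge> 1 \<and> poly (iter_comp u n) r = 0)"

definition assoc_seq :: "int poly \<Rightarrow> int \<Rightarrow> int list" where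
  "assoc_seq u r = map (\<lambda>k. poly (iter_comp u k) r) [0..<nilpotency_index u r] @ [0]"

text \<open>The eight families, where \<open>[:a, b:]\<close> is the linear polynomial \<open>b x + a\<close>.\<close>

definition form1 :: "int poly \<Rightarrow> int poly" where
  "form1 p = [:-4, 1:] * p"

definition form2 :: "int poly \<Rightarrow> int poly" where
  "form2 p = 3 * [:-3, 1:] + p * [:-3, 1:] * [:-4, 1:]"

definition form3 :: "int poly \<Rightarrow> int poly" where
  "form3 p = -3 * [:-6, 1:] + p * [:-4, 1:] * [:-6, 1:]"

definition form4 :: "int poly \<Rightarrow> int poly" where
  "form4 p = [:-2, 1:] + p * [:-2, 1:] * [:-4, 1:]"

definition form5 :: "int poly \<Rightarrow> int poly" where
  "form5 p = -2 * [:-8, 1:] + p * [:-4, 1:] * [:-8, 1:]"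

definition form6 :: "int poly \<Rightarrow> int poly" where
  "form6 p = -5 * [:-5, 1:] + p * [:-4, 1:] * [:-5, 1:]"

definition form7 :: "int poly \<Rightarrow> int poly" where
  "form7 p = [:-1, 1:] + p * [:-1, 1:] * [:-2, 1:] * [:-3, 1:] * [:-4, 1:]"

definition form8 :: "int poly \<Rightarrow> int poly" where
  "form8 p = - [:-13, 2:] * [:-3, 1:] + p * [:-3, 1:] * [:-4, 1:] * [:-5, 1:] * [:-6, 1:]"

end

theory Submission
  imports Defs
begin

text \<open>
  Write \<open>f\<close> for the polynomial function of \<open>u\<close>. If the orbit of \<open>4\<close> reaches \<open>0\<close>, let \<open>b\<close> be the
  element preceding \<open>0\<close>, so \<open>f b = 0\<close>. Since \<open>a - c\<close> divides \<open>f a - f c\<close>, each orbit element \<open>y\<close>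
  up to \<open>b\<close> satisfies \<open>f y - y dvd y\<close>, \<open>f y - y dvd b\<close> and \<open>y - b dvd f y\<close>. For \<open>y = 4\<close> this leaves
  finitely many pairs \<open>(f 4, b)\<close>, and from each pair the orbit can be followed. Unless it is one of
  the listed sequences, it violates a divisibility, runs into a 2-cycle, is an infinite arithmetic
  progression (when \<open>b = 4 - f 4 < 0\<close>), or is \<open>4, 6, 8, 10, 0\<close> or \<open>4, 8, 12, 0\<close>; these two pass all the
  divisibility tests but are not interpolated by an integer polynomial, because their second divided
  differences are not integral.
\<close>

section \<open>Index and associated sequence read off from explicit orbit values\<close>

lemma poly_iter_comp: "poly (iter_comp u n) r = (poly u ^^ n) r"
proof (induction n arbitrary: r)
  case (Suc n)
  have "iter_comp u (Suc n) = pcompose u (iter_comp u n)"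
    by (simp add: iter_comp_def)
  then show ?case
    using Suc by (simp add: poly_pcompose)
qed (simp add: iter_comp_def)

lemma nilpotency_index_eqI:
  assumes "m \<ge> 1" "(poly u ^^ m) r = 0" "\<And>k. 1 \<le> k \<Longrightarrow> k < m \<Longrightarrow> (poly u ^^ k) r \<noteq> 0"
  shows "nilpotency_index u r = m"
  unfolding nilpotency_index_def poly_iter_comp
  using assms by (intro Least_equality) (auto simp: not_less[symmetric])

lemma index_and_seq_1:
  assumes "poly u r = 0"
  shows "nilpotent_at u r \<and> nilpotency_index u r = 1 \<and> assoc_seq u r = [r, 0]"
proof -
  have "nilpotency_index u r = 1"
    using assms by (intro nilpotency_index_eqI) auto
  moreover have "nilpotent_at u r"
    unfolding nilpotent_at_def poly_iter_comp using assms by (intro exI[of _ 1]) simp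
  ultimately show ?thesis
    by (simp add: assoc_seq_def poly_iter_comp)
qed

lemma index_and_seq_2:
  assumes "poly u r = a" "poly u a = 0" "a \<noteq> 0"
  shows "nilpotent_at u r \<and> nilpotency_index u r = 2 \<and> assoc_seq u r = [r, a, 0]"
proof -
  have "nilpotency_index u r = 2"
    using assms by (intro nilpotency_index_eqI) (auto simp: less_Suc_eq numeral_eq_Suc)
  moreover have "nilpotent_at u r"
    unfolding nilpotent_at_def poly_iter_comp using assms
    by (intro exI[of _ 2]) (simp add: numeral_eq_Suc)
  ultimately show ?thesis
    using assms by (simp add: assoc_seq_def poly_iter_comp numeral_eq_Suc)
qed

lemma index_and_seq_4:
  assumes "poly u r = a" "poly u a = b" "poly u b = c" "poly u c = 0"
    and "a \<noteq> 0" "b \<noteq> 0" "c \<noteq> 0"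
  shows "nilpotent_at u r \<and> nilpotency_index u r = 4 \<and> assoc_seq u r = [r, a, b, c, 0]"
proof -
  have "nilpotency_index u r = 4"
    using assms by (intro nilpotency_index_eqI) (auto simp: less_Suc_eq numeral_eq_Suc)
  moreover have "nilpotent_at u r"
    unfolding nilpotent_at_def poly_iter_comp using assms
    by (intro exI[of _ 4]) (simp add: numeral_eq_Suc)
  ultimately show ?thesis
    using assms by (simp add: assoc_seq_def poly_iter_comp numeral_eq_Suc)
qed

section \<open>Divisibility for polynomials and for their values\<close>

lemma prod_linear_factors_dvd:
  fixes p :: "'a::idom poly"
  assumes "finite A" "\<And>a. a \<in> A \<Longrightarrow> poly p a = 0"
  shows "(\<Prod>a\<in>A. [:-a, 1:]) dvd p"
  using assms
proof (induction A rule: finite_induct)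
  case (insert x A)
  then obtain q where q: "p = (\<Prod>a\<in>A. [:-a, 1:]) * q"
    by (auto elim: dvdE)
  \<comment> \<open>As \<open>x\<close> is not in \<open>A\<close>, this value is nonzero and can be
    cancelled in the domain, so the root \<open>x\<close> of \<open>p\<close> passes to the cofactor
    \<open>q\<close>.\<close>
  have "(\<Prod>a\<in>A. x - a) \<noteq> 0"
    using insert.hyps by (auto simp: prod_zero_iff)
  then have "poly q x = 0"
    using insert.prems[of x] unfolding q by (simp add: poly_prod)
  then have "[:-x, 1:] dvd q"
    by (simp add: poly_eq_0_iff_dvd)
  then show ?case
    using insert.hyps unfolding q by (simp add: mult.commute[of _ q] mult_dvd_mono del: mult_pCons_left)
qed simp

lemma poly_diff_dvd:
  fixes u :: "'a::comm_ring_1 poly"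
  shows "a - c dvd poly u a - poly u c"
proof (induction u)
  case (pCons k u)
  have "poly (pCons k u) a - poly (pCons k u) c = (a - c) * poly u a + c * (poly u a - poly u c)"
    by (simp add: algebra_simps)
  then show ?case
    using pCons by (simp add: dvd_add)
qed simp

text \<open>With \<open>list_ex\<close> instead of set membership, the simplifier unfolds the interval for numerals.\<close>

lemma dvd_int_enum:
  fixes d n :: int
  assumes "d dvd n" "n \<noteq> 0"
  shows "list_ex (\<lambda>e. e dvd n \<and> d = e) [- \<bar>n\<bar>..\<bar>n\<bar>]"
proof -
  have "\<bar>d\<bar> \<le> \<bar>n\<bar>"
    using assms by (rule dvd_imp_le_int[rotated])
  then show ?thesis
    using assms by (auto simp: list_ex_iff)
qed

section \<open>Divisibility constraints on orbits that reach zero\<close>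

text \<open>Excluding \<open>0\<close> before \<open>b\<close> makes \<open>b\<close> the element preceding the first zero of the orbit.\<close>

definition reaches :: "int poly \<Rightarrow> int \<Rightarrow> int \<Rightarrow> bool" where
  "reaches u b y \<longleftrightarrow>
     poly u b = 0 \<and> (\<exists>n. (poly u ^^ n) y = b \<and> (\<forall>k\<le>n. (poly u ^^ k) y \<noteq> 0))"

lemma reaches_nonzero: "reaches u b y \<Longrightarrow> y \<noteq> 0"
  by (auto simp: reaches_def)

lemma reaches_target_nonzero: "reaches u b y \<Longrightarrow> b \<noteq> 0"
  by (auto simp: reaches_def)

lemma reaches_step:
  assumes "reaches u b y" "y \<noteq> b"
  shows "reaches u b (poly u y)"
proof -
  obtain n where n: "(poly u ^^ n) y = b" "\<forall>k\<le>n. (poly u ^^ k) y \<noteq> 0" "poly u b = 0"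
    using assms by (auto simp: reaches_def)
  with assms obtain m where m: "n = Suc m"
    by (cases n) auto
  have "(poly u ^^ k) (poly u y) = (poly u ^^ Suc k) y" for k
    by (simp add: funpow_swap1)
  with n show ?thesis
    unfolding reaches_def m by (metis Suc_le_mono)
qed

text \<open>Applying \<open>poly_diff_dvd\<close> to two consecutive orbit points shows that each
  increment divides the next one.\<close>

lemma increment_dvd_increment:
  fixes u :: "int poly"
  shows "poly u y - y dvd (poly u ^^ Suc k) y - (poly u ^^ k) y"
  by (induction k) (auto intro: dvd_trans poly_diff_dvd)

text \<open>The displacement telescopes into increments, all of them multiples of the first.\<close>

lemma increment_dvd_displacement:
  fixes u :: "int poly"
  shows "poly u y - y dvd (poly u ^^ k) y - y"
proof (induction k)
  case (Suc k)
  from dvd_add[OF increment_dvd_increment[of u y k] Suc] show ?case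
    by simp
qed simp

text \<open>The step from \<open>b\<close> to 0 has increment \<open>- b\<close>, the whole path
  from \<open>y\<close> to 0 has displacement \<open>- y\<close>, and comparing \<open>y\<close>
  with the root \<open>b\<close> gives the third divisibility.\<close>

lemma reaches_increment_dvd:
  assumes "reaches u b y"
  shows "poly u y - y dvd b" "poly u y - y dvd y" "y - b dvd poly u y"
proof -
  obtain n where n: "(poly u ^^ n) y = b" "poly u b = 0"
    using assms by (auto simp: reaches_def)
  show "poly u y - y dvd b"
    using increment_dvd_increment[of u y n] n by simp
  show "poly u y - y dvd y"
    using increment_dvd_displacement[of u y "Suc n"] n by simp
  show "y - b dvd poly u y"
    using poly_diff_dvd[of y b u] n by simp
qed

text \<open>This turns the orbit step into a finite search: for concrete \<open>y\<close> and
  \<open>b\<close> the simplifier evaluates every test and leaves only the surviving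
  successors.\<close>

lemma reaches_next:
  assumes "reaches u b y" "y \<noteq> b"
  shows "list_ex (\<lambda>z. z \<noteq> 0 \<and> z - y dvd y \<and> z - y dvd b \<and> y - b dvd z \<and> poly u y = z)
           [y - \<bar>y\<bar>..y + \<bar>y\<bar>]"
proof -
  have "\<bar>poly u y - y\<bar> \<le> \<bar>y\<bar>"
    using assms(1) reaches_increment_dvd(2) reaches_nonzero by (intro dvd_imp_le_int)
  moreover have "poly u y \<noteq> 0"
    using reaches_step[OF assms] by (rule reaches_nonzero)
  ultimately show ?thesis
    using reaches_increment_dvd[OF assms(1)] by (auto simp: list_ex_iff)
qed

text \<open>The orbit would stay in \<open>{y, z}\<close>, where both points are nonzero, yet the
  step after \<open>b\<close> gives 0.\<close>

lemma reaches_no_two_cycle: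
  assumes "reaches u b y" "poly u y = z" "poly u z = y" "z \<noteq> 0"
  shows False
proof -
  obtain n where n: "(poly u ^^ n) y = b" "poly u b = 0"
    using assms by (auto simp: reaches_def)
  have "(poly u ^^ k) y \<in> {y, z}" for k
    by (induction k) (use assms in auto)
  from this[of "Suc n"] show ?thesis
    using n assms reaches_nonzero by auto
qed

text \<open>Every later increment is a multiple of \<open>d\<close> and divides the target
  \<open>- d\<close>, so it is \<open>d\<close> or \<open>- d\<close>. The latter closes a 2-cycle;
  hence the orbit increases forever through positive values and misses \<open>- d\<close>.\<close>

lemma progression_not_reaches:
  fixes d y :: int
  assumes "d > 0" "y > 0" "poly u y = y + d"
  shows "\<not> reaches u (- d) y"
proof
  assume r: "reaches u (- d) y"
  have "reaches u (- d) (y + int n * d) \<and> poly u (y + int n * d) = y + int (Suc n) * d" for n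
  proof (induction n)
    case 0
    show ?case using r assms by simp
  next
    case (Suc n)
    define x where "x = y + int n * d"
    have x: "x > 0" "y + int (Suc n) * d = x + d" "y + int (Suc (Suc n)) * d = x + d + d"
      using assms by (simp_all add: x_def algebra_simps add_pos_nonneg)
    have rx: "reaches u (- d) x" and ux: "poly u x = x + d"
      using Suc x by (simp_all add: x_def)
    then have rx': "reaches u (- d) (x + d)"
      using reaches_step[OF rx] x \<open>d > 0\<close> by simp
    define e where "e = poly u (x + d) - (x + d)"
    have "e dvd d"
      using reaches_increment_dvd(1)[OF rx'] by (simp add: e_def)
    \<comment> \<open>Since \<open>poly u x = x + d\<close>, the number \<open>e\<close> is the
      difference of the values of \<open>u\<close> at \<open>x + d\<close> and
      \<open>x\<close>.\<close>
    moreover have "d dvd e"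
      using poly_diff_dvd[of "x + d" x u] ux by (simp add: e_def algebra_simps)
    ultimately have "\<bar>e\<bar> = \<bar>d\<bar>"
      by (rule zdvd_antisym_abs)
    \<comment> \<open>With \<open>e = - d\<close> the point \<open>x + d\<close> would be sent back
      to \<open>x\<close>.\<close>
    moreover have "e \<noteq> - d"
      using reaches_no_two_cycle[OF rx ux] x \<open>d > 0\<close> by (auto simp: e_def)
    ultimately have "poly u (x + d) = x + d + d"
      by (auto simp: e_def)
    then show ?case
      using rx' x by simp
  qed
  moreover obtain n where "(poly u ^^ n) y = - d"
    using r by (auto simp: reaches_def)
  moreover have "(poly u ^^ n) y = y + int n * d"
    using calculation(1) by (induction n) auto
  ultimately show False
    using assms by (smt (verit) mult_nonneg_nonneg of_nat_0_le_iff)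
qed

section \<open>Obstructions from second divided differences\<close>

lemma poly_minus_value:
  fixes u :: "'a::idom poly"
  obtains q where "u = [:poly u c:] + [:-c, 1:] * q"
proof -
  have "[:-c, 1:] dvd u - [:poly u c:]"
    by (simp add: poly_eq_0_iff_dvd[symmetric])
  then show ?thesis
    by (metis that dvdE diff_add_cancel add.commute)
qed

text \<open>The quotient \<open>q\<close> of \<open>u - 6\<close> by \<open>x - 4\<close> is again
  integral, with values 1 at 6 and -1 at 10; then 4 would divide -2.\<close>

lemma not_interpolated_4_6_8_10:
  fixes u :: "int poly"
  assumes "poly u 4 = 6" "poly u 6 = 8" "poly u 10 = 0"
  shows False
proof -
  obtain q where "u = [:poly u 4:] + [:-4, 1:] * q"
    by (rule poly_minus_value)
  then have "poly u x = 6 + (x - 4) * poly q x" for x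
    using assms(1) by (subst \<open>u = _\<close>) (simp add: algebra_simps)
  from this[of 6] this[of 10] assms have "poly q 6 = 1" "poly q 10 = -1"
    by simp_all
  with poly_diff_dvd[of 10 6 q] show False
    by simp
qed

text \<open>Again 4 would divide -2, now through the values 1 and -1 of the integral quotient at 8
  and 12.\<close>

lemma not_interpolated_4_8_12:
  fixes u :: "int poly"
  assumes "poly u 4 = 8" "poly u 8 = 12" "poly u 12 = 0"
  shows False
proof -
  obtain q where "u = [:poly u 4:] + [:-4, 1:] * q"
    by (rule poly_minus_value)
  then have "poly u x = 8 + (x - 4) * poly q x" for x
    using assms(1) by (subst \<open>u = _\<close>) (simp add: algebra_simps)
  from this[of 8] this[of 12] assms have "poly q 8 = 1" "poly q 12 = -1"
    by simp_all
  with poly_diff_dvd[of 12 8 q] show False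
    by simp
qed

section \<open>Case analysis of the orbits of 4 with index above 1\<close>

lemma reaches_from_4:
  assumes r4: "reaches u b 4" and b4: "b \<noteq> 4"
  shows "(\<exists>a\<in>{2, 3, 5, 6, 8}. poly u 4 = a \<and> poly u a = 0) \<or>
    (poly u 4 = 3 \<and> poly u 3 = 2 \<and> poly u 2 = 1 \<and> poly u 1 = 0) \<or>
    (poly u 4 = 5 \<and> poly u 5 = 6 \<and> poly u 6 = 3 \<and> poly u 3 = 0)"
proof -
  \<comment> \<open>Unfolds the integer intervals, so that each \<open>list_ex\<close> fact becomes
    an explicit disjunction.\<close>
  note [simp] = upto_rec1
  have ub: "poly u b = 0"
    using r4 by (simp add: reaches_def)
  have ra: "reaches u b (poly u 4)"
    using reaches_step[OF r4] b4 by simp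
  \<comment> \<open>Once \<open>poly u 4\<close> is known, its divisors \<open>4 - b\<close> leave
    finitely many candidates for \<open>b\<close>.\<close>
  have b: "list_ex (\<lambda>e. e dvd poly u 4 \<and> 4 - b = e) [- \<bar>poly u 4\<bar>..\<bar>poly u 4\<bar>]"
    using reaches_increment_dvd(3)[OF r4] reaches_nonzero[OF ra] by (rule dvd_int_enum)
  have d4: "poly u 4 - 4 dvd b"
    using reaches_increment_dvd(1)[OF r4] .
  have d: "poly u 4 - 4 dvd poly u (poly u 4) - poly u 4"
    by (rule poly_diff_dvd)
  have "list_ex (\<lambda>e. e dvd 4 \<and> poly u 4 - 4 = e) [- \<bar>4\<bar>..\<bar>4\<bar>]"
    using reaches_increment_dvd(2)[OF r4] by (rule dvd_int_enum) simp
  then have "poly u 4 \<in> {0, 2, 3, 5, 6, 8}"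
    by auto
  then consider "poly u 4 = 2" | "poly u 4 = 3" | "poly u 4 = 5" | "poly u 4 = 6" | "poly u 4 = 8"
    using reaches_nonzero[OF ra] by auto
  then show ?thesis
  proof cases
    case 1
    have "b = 2 \<or> b = 6"
      using b d4 b4 by (auto simp: 1)
    then show ?thesis
    proof
      assume [simp]: "b = 6"
      have r2: "reaches u 6 2"
        using ra 1 by simp
      have "poly u 2 = 4"
        using reaches_next[OF r2] by auto
      then show ?thesis
        using reaches_no_two_cycle[OF r2 _ 1] by simp
    qed (use 1 ub in auto)
  next
    case 2
    have "b = 1 \<or> b = 3 \<or> b = 5 \<or> b = 7"
      using b d4 by (auto simp: 2)
    then show ?thesis
    proof (elim disjE)
      assume [simp]: "b = 1"
      have r3: "reaches u 1 3"
        using ra 2 by simp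
      have u3: "poly u 3 = 2"
        using reaches_next[OF r3] reaches_no_two_cycle[OF r3 _ 2] by auto
      have r2: "reaches u 1 2"
        using reaches_step[OF r3] u3 by simp
      have "poly u 2 = 1"
        using reaches_next[OF r2] reaches_no_two_cycle[OF r2 _ u3] by auto
      then show ?thesis
        using 2 u3 ub by auto
    next
      assume [simp]: "b = 5"
      have r3: "reaches u 5 3"
        using ra 2 by simp
      have u3: "poly u 3 = 2"
        using reaches_next[OF r3] reaches_no_two_cycle[OF r3 _ 2] by auto
      have r2: "reaches u 5 2"
        using reaches_step[OF r3] u3 by simp
      show ?thesis
        using reaches_next[OF r2] reaches_no_two_cycle[OF r2 _ u3] by auto
    next
      assume [simp]: "b = 7"
      have r3: "reaches u 7 3"
        using ra 2 by simp
      show ?thesis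
        using reaches_next[OF r3] reaches_no_two_cycle[OF r3 _ 2] by auto
    qed (use 2 ub in auto)
  next
    case 3
    have "b = -1 \<or> b = 3 \<or> b = 5 \<or> b = 9"
      using b d4 by (auto simp: 3)
    then show ?thesis
    proof (elim disjE)
      assume "b = -1"
      then show ?thesis
        using progression_not_reaches[of 1 4 u] r4 3 by simp
    next
      assume [simp]: "b = 3"
      have r5: "reaches u 3 5"
        using ra 3 by simp
      have u5: "poly u 5 = 6"
        using reaches_next[OF r5] reaches_no_two_cycle[OF r5 _ 3] by auto
      have r6: "reaches u 3 6"
        using reaches_step[OF r5] u5 by simp
      have "poly u 6 = 3 \<or> poly u 6 = 9"
        using reaches_next[OF r6] by auto
      moreover have "poly u 6 \<noteq> 9"
      proof
        assume u6: "poly u 6 = 9"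
        have r9: "reaches u 3 9"
          using reaches_step[OF r6] u6 by simp
        have "poly u 9 = 12"
          using reaches_next[OF r9] reaches_no_two_cycle[OF r9 _ u6] by auto
        \<comment> \<open>The successor 12 of 9 passes the tests against 9 and \<open>b\<close>;
          comparing the values at 9 and 4 instead, 5 would have to divide 7.\<close>
        then show False
          using poly_diff_dvd[of 9 4 u] 3 by simp
      qed
      ultimately show ?thesis
        using 3 u5 ub by auto
    next
      assume [simp]: "b = 9"
      have r5: "reaches u 9 5"
        using ra 3 by simp
      show ?thesis
        using reaches_next[OF r5] reaches_no_two_cycle[OF r5 _ 3] by auto
    qed (use 3 ub in auto)
  next
    case 4
    have "b = -2 \<or> b = 2 \<or> b = 6 \<or> b = 10"
      using b d4 by (auto simp: 4)
    then show ?thesis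
    proof (elim disjE)
      assume "b = -2"
      then show ?thesis
        using progression_not_reaches[of 2 4 u] r4 4 by simp
    next
      assume [simp]: "b = 2"
      have r6: "reaches u 2 6"
        using ra 4 by simp
      have u6: "poly u 6 = 8"
        using reaches_next[OF r6] reaches_no_two_cycle[OF r6 _ 4] d 4 by auto
      have r8: "reaches u 2 8"
        using reaches_step[OF r6] u6 by simp
      show ?thesis
        using reaches_next[OF r8] reaches_no_two_cycle[OF r8 _ u6] poly_diff_dvd[of 8 6 u] u6
        by auto
    next
      assume [simp]: "b = 10"
      have r6: "reaches u 10 6"
        using ra 4 by simp
      have u6: "poly u 6 = 8"
        using reaches_next[OF r6] reaches_no_two_cycle[OF r6 _ 4] d 4 by auto
      then show ?thesis
        using not_interpolated_4_6_8_10[OF 4] ub by simp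
    qed (use 4 ub in auto)
  next
    case 5
    \<comment> \<open>The value 0 passes both divisibility tests for \<open>b\<close> here and is
      excluded by \<open>reaches_target_nonzero\<close>.\<close>
    have "b = -4 \<or> b = 8 \<or> b = 12"
      using b d4 reaches_target_nonzero[OF r4] by (auto simp: 5)
    then show ?thesis
    proof (elim disjE)
      assume "b = -4"
      then show ?thesis
        using progression_not_reaches[of 4 4 u] r4 5 by simp
    next
      assume [simp]: "b = 12"
      have r8: "reaches u 12 8"
        using ra 5 by simp
      have "poly u 8 = 12"
        using reaches_next[OF r8] reaches_no_two_cycle[OF r8 _ 5] d 5 by auto
      then show ?thesis
        using not_interpolated_4_8_12[OF 5] ub by simp
    qed (use 5 ub in auto)
  qed
qed

section \<open>From nilpotency to orbit data, and from orbit values to the families\<close>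

lemma nilpotent_at_imp_reaches:
  assumes "nilpotent_at u r" "r \<noteq> 0"
  shows "\<exists>b. reaches u b r"
proof -
  define m where "m = (LEAST m. (poly u ^^ m) r = 0)"
  obtain n where "(poly u ^^ n) r = 0"
    using assms by (auto simp: nilpotent_at_def poly_iter_comp)
  then have m: "(poly u ^^ m) r = 0" "\<And>k. k < m \<Longrightarrow> (poly u ^^ k) r \<noteq> 0"
    unfolding m_def by (auto intro: LeastI dest: not_less_Least)
  \<comment> \<open>The minimum \<open>m\<close> ranges over all naturals, and
    \<open>r \<noteq> 0\<close> rules out \<open>m = 0\<close>; the point one step before the first
    zero serves as \<open>b\<close>.\<close>
  with assms obtain n where n: "m = Suc n"
    by (cases m) auto
  then show ?thesis
    unfolding reaches_def using m by (intro exI[of _ "(poly u ^^ n) r"]) auto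
qed

text \<open>As in all the lemmas of this group, the parameter-free term of the family (here 0) takes
  the prescribed values. Its difference from \<open>u\<close> vanishes at the nodes, hence is a
  multiple of the product of their linear factors.\<close>

lemma form1I:
  assumes "poly u 4 = 0"
  shows "\<exists>p. u = form1 p"
proof -
  have "(\<Prod>a\<in>{4}. [:-a, 1:]) dvd u - (0)"
    using assms by (intro prod_linear_factors_dvd) auto
  then obtain p where "u = (0) + (\<Prod>a\<in>{4}. [:-a, 1:]) * p"
    by (metis dvdE diff_add_cancel add.commute)
  then have "u = form1 p"
    unfolding form1_def by (simp add: mult_ac del: mult_pCons_left mult_pCons_right)
  then show ?thesis ..
qed

lemma form2I:
  assumes "poly u 4 = 3" "poly u 3 = 0"
  shows "\<exists>p. u = form2 p"
proof -
  have "(\<Prod>a\<in>{3, 4}. [:-a, 1:]) dvd u - (3 * [:-3, 1:])"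
    using assms by (intro prod_linear_factors_dvd) auto
  then obtain p where "u = (3 * [:-3, 1:]) + (\<Prod>a\<in>{3, 4}. [:-a, 1:]) * p"
    by (metis dvdE diff_add_cancel add.commute)
  then have "u = form2 p"
    unfolding form2_def by (simp add: mult_ac del: mult_pCons_left mult_pCons_right)
  then show ?thesis ..
qed

lemma form3I:
  assumes "poly u 4 = 6" "poly u 6 = 0"
  shows "\<exists>p. u = form3 p"
proof -
  have "(\<Prod>a\<in>{4, 6}. [:-a, 1:]) dvd u - (-3 * [:-6, 1:])"
    using assms by (intro prod_linear_factors_dvd) auto
  then obtain p where "u = (-3 * [:-6, 1:]) + (\<Prod>a\<in>{4, 6}. [:-a, 1:]) * p"
    by (metis dvdE diff_add_cancel add.commute)
  then have "u = form3 p"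
    unfolding form3_def by (simp add: mult_ac del: mult_pCons_left mult_pCons_right)
  then show ?thesis ..
qed

lemma form4I:
  assumes "poly u 4 = 2" "poly u 2 = 0"
  shows "\<exists>p. u = form4 p"
proof -
  have "(\<Prod>a\<in>{2, 4}. [:-a, 1:]) dvd u - ([:-2, 1:])"
    using assms by (intro prod_linear_factors_dvd) auto
  then obtain p where "u = ([:-2, 1:]) + (\<Prod>a\<in>{2, 4}. [:-a, 1:]) * p"
    by (metis dvdE diff_add_cancel add.commute)
  then have "u = form4 p"
    unfolding form4_def by (simp add: mult_ac del: mult_pCons_left mult_pCons_right)
  then show ?thesis ..
qed

lemma form5I:
  assumes "poly u 4 = 8" "poly u 8 = 0"
  shows "\<exists>p. u = form5 p"
proof -
  have "(\<Prod>a\<in>{4, 8}. [:-a, 1:]) dvd u - (-2 * [:-8, 1:])"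
    using assms by (intro prod_linear_factors_dvd) auto
  then obtain p where "u = (-2 * [:-8, 1:]) + (\<Prod>a\<in>{4, 8}. [:-a, 1:]) * p"
    by (metis dvdE diff_add_cancel add.commute)
  then have "u = form5 p"
    unfolding form5_def by (simp add: mult_ac del: mult_pCons_left mult_pCons_right)
  then show ?thesis ..
qed

lemma form6I:
  assumes "poly u 4 = 5" "poly u 5 = 0"
  shows "\<exists>p. u = form6 p"
proof -
  have "(\<Prod>a\<in>{4, 5}. [:-a, 1:]) dvd u - (-5 * [:-5, 1:])"
    using assms by (intro prod_linear_factors_dvd) auto
  then obtain p where "u = (-5 * [:-5, 1:]) + (\<Prod>a\<in>{4, 5}. [:-a, 1:]) * p"
    by (metis dvdE diff_add_cancel add.commute)
  then have "u = form6 p"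
    unfolding form6_def by (simp add: mult_ac del: mult_pCons_left mult_pCons_right)
  then show ?thesis ..
qed

lemma form7I:
  assumes "poly u 4 = 3" "poly u 3 = 2" "poly u 2 = 1" "poly u 1 = 0"
  shows "\<exists>p. u = form7 p"
proof -
  have "(\<Prod>a\<in>{1, 2, 3, 4}. [:-a, 1:]) dvd u - ([:-1, 1:])"
    using assms by (intro prod_linear_factors_dvd) auto
  then obtain p where "u = ([:-1, 1:]) + (\<Prod>a\<in>{1, 2, 3, 4}. [:-a, 1:]) * p"
    by (metis dvdE diff_add_cancel add.commute)
  then have "u = form7 p"
    unfolding form7_def by (simp add: mult_ac del: mult_pCons_left mult_pCons_right)
  then show ?thesis ..
qed

lemma form8I:
  assumes "poly u 4 = 5" "poly u 5 = 6" "poly u 6 = 3" "poly u 3 = 0"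
  shows "\<exists>p. u = form8 p"
proof -
  have "(\<Prod>a\<in>{3, 4, 5, 6}. [:-a, 1:]) dvd u - (- [:-13, 2:] * [:-3, 1:])"
    using assms by (intro prod_linear_factors_dvd) auto
  then obtain p where "u = (- [:-13, 2:] * [:-3, 1:]) + (\<Prod>a\<in>{3, 4, 5, 6}. [:-a, 1:]) * p"
    by (metis dvdE diff_add_cancel add.commute)
  then have "u = form8 p"
    unfolding form8_def by (simp add: mult_ac del: mult_pCons_left mult_pCons_right)
  then show ?thesis ..
qed

theorem theorem3p5:
  fixes u :: "int poly"
  shows "(u \<in> nilpotent_polys 4 \<longleftrightarrow>
            (\<exists>p. u = form1 p) \<or> (\<exists>p. u = form2 p) \<or> (\<exists>p. u = form3 p) \<or> (\<exists>p. u = form4 p) \<or>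
            (\<exists>p. u = form5 p) \<or> (\<exists>p. u = form6 p) \<or> (\<exists>p. u = form7 p) \<or> (\<exists>p. u = form8 p))
       \<and> (\<forall>p. u = form1 p \<longrightarrow> nilpotency_index u 4 = 1 \<and> assoc_seq u 4 = [4, 0])
       \<and> (\<forall>p. u = form2 p \<longrightarrow> nilpotency_index u 4 = 2 \<and> assoc_seq u 4 = [4, 3, 0])
       \<and> (\<forall>p. u = form3 p \<longrightarrow> nilpotency_index u 4 = 2 \<and> assoc_seq u 4 = [4, 6, 0])
       \<and> (\<forall>p. u = form4 p \<longrightarrow> nilpotency_index u 4 = 2 \<and> assoc_seq u 4 = [4, 2, 0])
       \<and> (\<forall>p. u = form5 p \<longrightarrow> nilpotency_index u 4 = 2 \<and> assoc_seq u 4 = [4, 8, 0])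
       \<and> (\<forall>p. u = form6 p \<longrightarrow> nilpotency_index u 4 = 2 \<and> assoc_seq u 4 = [4, 5, 0])
       \<and> (\<forall>p. u = form7 p \<longrightarrow> nilpotency_index u 4 = 4 \<and> assoc_seq u 4 = [4, 3, 2, 1, 0])
       \<and> (\<forall>p. u = form8 p \<longrightarrow> nilpotency_index u 4 = 4 \<and> assoc_seq u 4 = [4, 5, 6, 3, 0])"
proof -
  note evals = form1_def form2_def form3_def form4_def form5_def form6_def form7_def form8_def
  have 1: "nilpotent_at u 4 \<and> nilpotency_index u 4 = 1 \<and> assoc_seq u 4 = [4, 0]"
    if "u = form1 p" for p
    by (rule index_and_seq_1) (simp add: that evals)
  have 2: "nilpotent_at u 4 \<and> nilpotency_index u 4 = 2 \<and> assoc_seq u 4 = [4, 3, 0]"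
    if "u = form2 p" for p
    by (rule index_and_seq_2) (simp_all add: that evals)
  have 3: "nilpotent_at u 4 \<and> nilpotency_index u 4 = 2 \<and> assoc_seq u 4 = [4, 6, 0]"
    if "u = form3 p" for p
    by (rule index_and_seq_2) (simp_all add: that evals)
  have 4: "nilpotent_at u 4 \<and> nilpotency_index u 4 = 2 \<and> assoc_seq u 4 = [4, 2, 0]"
    if "u = form4 p" for p
    by (rule index_and_seq_2) (simp_all add: that evals)
  have 5: "nilpotent_at u 4 \<and> nilpotency_index u 4 = 2 \<and> assoc_seq u 4 = [4, 8, 0]"
    if "u = form5 p" for p
    by (rule index_and_seq_2) (simp_all add: that evals)
  have 6: "nilpotent_at u 4 \<and> nilpotency_index u 4 = 2 \<and> assoc_seq u 4 = [4, 5, 0]"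
    if "u = form6 p" for p
    by (rule index_and_seq_2) (simp_all add: that evals)
  have 7: "nilpotent_at u 4 \<and> nilpotency_index u 4 = 4 \<and> assoc_seq u 4 = [4, 3, 2, 1, 0]"
    if "u = form7 p" for p
    by (rule index_and_seq_4) (simp_all add: that evals)
  have 8: "nilpotent_at u 4 \<and> nilpotency_index u 4 = 4 \<and> assoc_seq u 4 = [4, 5, 6, 3, 0]"
    if "u = form8 p" for p
    by (rule index_and_seq_4) (simp_all add: that evals)
  have "(\<exists>p. u = form1 p) \<or> (\<exists>p. u = form2 p) \<or> (\<exists>p. u = form3 p) \<or> (\<exists>p. u = form4 p) \<or>
      (\<exists>p. u = form5 p) \<or> (\<exists>p. u = form6 p) \<or> (\<exists>p. u = form7 p) \<or> (\<exists>p. u = form8 p)"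
    if nil: "nilpotent_at u 4"
  proof -
    obtain b where b: "reaches u b 4"
      using nilpotent_at_imp_reaches[OF nil] by auto
    show ?thesis
    proof (cases "b = 4")
      \<comment> \<open>Here 4 itself is the element preceding 0, which gives the first
        family.\<close>
      case True
      then show ?thesis
        using b form1I[of u] by (simp add: reaches_def)
    next
      case False
      from reaches_from_4[OF b False] show ?thesis
        using form2I[of u] form3I[of u] form4I[of u] form5I[of u] form6I[of u] form7I[of u]
          form8I[of u] by auto
    qed
  qed
  with 1 2 3 4 5 6 7 8 show ?thesis
    unfolding nilpotent_polys_def mem_Collect_eq by blast
qed

end
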